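(* Let $X$ be a finite set, let $G$ be a subgroup of $\mathrm{Aut}(X)$ that acts transitively on $X$, and let $F$ be a map from $\mathbb{R}^X$ to $\mathbb{R}^X$. Then $F$ is a linear group equivariant operator for $(\mathbb{R}^X,G)$ if and only if there exists a permutant measure $\mu$ with respect to $G$ such that $$F(\varphi)=\sum_{h\in \mathrm{Aut}(X)}\varphi h^{-1}\,\mu(h)\quad\text{for every }\varphi\in\mathbb{R}^X.$$
   Context: $X$ is a finite (nonempty) set and $\mathbb{R}^X$ is the vector space of all functions $X\to\mathbb{R}$. $\mathrm{Aut}(X)$ is the group of all permutations of $X$; it acts on $\mathbb{R}^X$ by composition on the right, and juxtaposition denotes composition of functions: $\varphi g=\varphi\circ g$, $h_1h_2=h_1\circ h_2$. For a subgroup $G\subseteq\mathrm{Aut}(X)$, a group equivariant operator (GEO) for $(\mathbb{R}^X,G)$ is a function $F:\mathbb{R}^X\to\mathbb{R}^X$ such that $F(\varphi g)=F(\varphi)g$ for all $\varphi\in\mathbb{R}^X$ and $g\in G$. A permutant measure with respect to $G$ is a finite signed measure $\mu$ on $\mathrm{Aut}(X)$ for which every subset of $\mathrm{Aut}(X)$ is measurable and $\mu(H)=\mu(gHg^{-1})$ for every $H\subseteq\mathrm{Aut}(X)$ and every $g\in G$ (equivalently, $\mu(\{h\})=\mu(\{ghg^{-1}\})$ for all $h\in\mathrm{Aut}(X)$, $g\in G$). One writes $\mu(h)$ for $\mu(\{h\})$. *)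

theory Defs
  imports "HOL-Algebra.Group_Action" "HOL-Analysis.Sigma_Algebra" "HOL-Library.Function_Algebras"
begin

abbreviation Aut_group :: "('x \<Rightarrow> 'x) monoid" where
  "Aut_group \<equiv> BijGroup UNIV"

abbreviation Aut :: "('x \<Rightarrow> 'x) set" where
  "Aut \<equiv> carrier Aut_group"

(* Plain inv is ambiguous in the presence of HOL-Algebra, so the inverse function of h is
   written inv_into UNIV h. *)

definition scale_fun :: "real \<Rightarrow> ('x \<Rightarrow> real) \<Rightarrow> ('x \<Rightarrow> real)" where
  "scale_fun c \<phi> = (\<lambda>x. c * \<phi> x)"

definition transitive_on_points :: "('x \<Rightarrow> 'x) set \<Rightarrow> bool" where
  "transitive_on_points G \<longleftrightarrow> transitive_action (Aut_group\<lparr>carrier := G\<rparr>) UNIV (\<lambda>g. g)"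

definition GEO :: "('x \<Rightarrow> 'x) set \<Rightarrow> (('x \<Rightarrow> real) \<Rightarrow> ('x \<Rightarrow> real)) \<Rightarrow> bool" where
  "GEO G F \<longleftrightarrow> (\<forall>\<phi>. \<forall>g\<in>G. F (\<phi> \<circ> g) = F \<phi> \<circ> g)"

definition linear_GEO :: "('x \<Rightarrow> 'x) set \<Rightarrow> (('x \<Rightarrow> real) \<Rightarrow> ('x \<Rightarrow> real)) \<Rightarrow> bool" where
  "linear_GEO G F \<longleftrightarrow> Vector_Spaces.linear scale_fun scale_fun F \<and> GEO G F"

definition finite_signed_measure :: "'a set \<Rightarrow> 'a set set \<Rightarrow> ('a set \<Rightarrow> real) \<Rightarrow> bool" where
  "finite_signed_measure \<Omega> M \<mu> \<longleftrightarrow>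
     sigma_algebra \<Omega> M \<and> \<mu> {} = 0 \<and>
     (\<forall>A :: nat \<Rightarrow> 'a set. range A \<subseteq> M \<longrightarrow> disjoint_family A \<longrightarrow>
        (\<lambda>n. \<mu> (A n)) sums \<mu> (\<Union>n. A n))"

(* Values of \<mu> on sets that are not subsets of Aut are irrelevant. *)
definition permutant_measure :: "('x \<Rightarrow> 'x) set \<Rightarrow> (('x \<Rightarrow> 'x) set \<Rightarrow> real) \<Rightarrow> bool" where
  "permutant_measure G \<mu> \<longleftrightarrow>
     finite_signed_measure Aut (Pow Aut) \<mu> \<and>
     (\<forall>H g. H \<subseteq> Aut \<longrightarrow> g \<in> G \<longrightarrow> \<mu> H = \<mu> ((\<lambda>h. g \<circ> h \<circ> inv_into UNIV g) ` H))"

end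

theory Submission
  imports Defs "HOL-Combinatorics.Permutations" "HOL-Library.Cardinality"
begin

text \<open>
  A linear operator \<open>F\<close> on functions on the finite set \<open>X\<close> is a matrix \<open>A\<close>, and \<open>F\<close> is
  equivariant exactly when \<open>A (g x) (g y) = A x y\<close> for all \<open>g \<in> G\<close>.  The operator
  \<open>\<phi> \<mapsto> \<phi> h\<^sup>-\<^sup>1\<close> is the permutation matrix of \<open>h\<close>, so a measure representing \<open>F\<close> is a way of
  writing \<open>A\<close> as a linear combination of permutation matrices, with coefficients that are
  constant on conjugacy classes under \<open>G\<close>.

  Transitivity of \<open>G\<close> makes all row sums of an invariant \<open>A\<close> equal, and likewise all column
  sums; since both families add up to the total of all entries, every line of \<open>A\<close> has the same
  sum \<open>s\<close>.  A matrix with this property is a combination of permutation matrices with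
  \<^emph>\<open>explicit\<close> coefficients.  Let \<open>n \<ge> 2\<close> be the size of \<open>X\<close> and give \<open>h\<close> the weight
  \<open>t h = (\<Sum>y. A (h y) y)\<close>.  The entry at \<open>(u, v)\<close> of the resulting combination is the
  sum of \<open>t h\<close> over all \<open>h\<close> with \<open>h v = u\<close>.  In it \<open>A u v\<close> occurs
  \<open>(n - 1)!\<close> times, an entry outside row \<open>u\<close> and column \<open>v\<close> occurs \<open>(n - 2)!\<close> times, and the
  other entries of that row and column do not occur.  The entries outside that row and column
  add up to \<open>n s - 2 s + A u v\<close>, so the combination is a positive multiple of \<open>A\<close> plus a
  constant matrix.  The constant is removed by subtracting a constant from the weights, and
  normalising gives \<open>permutation_weight\<close>, whose formula also covers a single point; this is
  lemma \<open>sum_permutation_weight\<close>.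

  The weight \<open>t h\<close> is the trace of the product of \<open>A\<close> with a permutation matrix, so for an
  invariant \<open>A\<close> it does not change when \<open>h\<close> is conjugated by an element of \<open>G\<close>.  Hence the
  coefficients form a permutant measure.

  Conversely, substituting \<open>g h g\<^sup>-\<^sup>1\<close> for \<open>h\<close> in the sum turns the
  conjugation invariance of the measure into equivariance of the operator.
\<close>

section \<open>Counting permutations with prescribed values\<close>

text \<open>Dividing by one permutation \<open>k\<close> with the prescribed values on \<open>S\<close> turns the others into
  the permutations of the complement of \<open>S\<close>.\<close>

lemma card_bij_agreeing_on:
  fixes k :: "'a::finite \<Rightarrow> 'a"
  assumes "bij k"
  shows "card {h. bij h \<and> (\<forall>a\<in>S. h a = k a)} = fact (CARD('a) - card S)"
proof -
  have "bij_betw (\<lambda>p. k \<circ> p) {p. p permutes - S} {h. bij h \<and> (\<forall>a\<in>S. h a = k a)}"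
  proof (rule bij_betw_byWitness[where f' = "\<lambda>h. inv_into UNIV k \<circ> h"])
    show "\<forall>p\<in>{p. p permutes - S}. inv_into UNIV k \<circ> (k \<circ> p) = p"
      using assms by (simp add: fun_eq_iff bij_is_inj)
    show "\<forall>h\<in>{h. bij h \<and> (\<forall>a\<in>S. h a = k a)}. k \<circ> (inv_into UNIV k \<circ> h) = h"
      using assms by (simp add: fun_eq_iff bij_is_surj surj_f_inv_f)
    show "(\<lambda>p. k \<circ> p) ` {p. p permutes - S} \<subseteq> {h. bij h \<and> (\<forall>a\<in>S. h a = k a)}"
      using assms by (auto simp: permutes_bij bij_comp permutes_not_in)
    show "(\<lambda>h. inv_into UNIV k \<circ> h) ` {h. bij h \<and> (\<forall>a\<in>S. h a = k a)} \<subseteq> {p. p permutes - S}"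
    proof clarify
      fix h assume h: "bij h" "\<forall>a\<in>S. h a = k a"
      from h(1) have "bij (inv_into UNIV k \<circ> h)"
        using assms by (intro bij_comp bij_imp_bij_inv)
      moreover have "(inv_into UNIV k \<circ> h) a = a" if "a \<notin> - S" for a
        using h(2) that assms by (simp add: bij_is_inj)
      ultimately show "inv_into UNIV k \<circ> h permutes - S"
        unfolding permutes_def bij_iff by blast
    qed
  qed
  then have "card {h. bij h \<and> (\<forall>a\<in>S. h a = k a)} = card {p. p permutes - S}"
    by (simp add: bij_betw_same_card)
  also have "\<dots> = fact (CARD('a) - card S)"
    by (intro card_permutations) (auto simp: Compl_eq_Diff_UNIV card_Diff_subset)
  finally show ?thesis .
qed

lemma card_bij_one_value:
  fixes u v :: "'a::finite"
  shows "card {h. bij h \<and> h v = u} = fact (CARD('a) - 1)"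
  using card_bij_agreeing_on[of "Transposition.transpose v u" "{v}"] by simp

lemma card_bij_two_values:
  fixes u v x y :: "'a::finite"
  assumes "u \<noteq> x" "v \<noteq> y"
  shows "card {h. bij h \<and> h v = u \<and> h y = x} = fact (CARD('a) - 2)"
proof -
  \<comment> \<open>The first factor sends \<open>v\<close> to \<open>u\<close>; the second corrects the image of \<open>y\<close>, which differs
    from \<open>u\<close>, and so leaves \<open>u\<close> in place.\<close>
  define k where "k = Transposition.transpose (Transposition.transpose v u y) x
                        \<circ> Transposition.transpose v u"
  have "Transposition.transpose v u y \<noteq> u"
    using assms by (metis transpose_apply_first transpose_eq_iff)
  then have "k v = u" "k y = x"
    using assms by (auto simp: k_def transpose_apply_other)
  moreover have "bij k"
    by (simp add: k_def bij_comp)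
  ultimately show ?thesis
    using card_bij_agreeing_on[of k "{v, y}"] assms by (simp add: conj_ac numeral_2_eq_2)
qed

section \<open>Matrices with constant line sums\<close>

definition permutation_weight :: "('x::finite \<Rightarrow> 'x \<Rightarrow> real) \<Rightarrow> real \<Rightarrow> ('x \<Rightarrow> 'x) \<Rightarrow> real" where
  "permutation_weight A s h =
     ((real CARD('x) - 1) * (\<Sum>y\<in>UNIV. A (h y) y) - (real CARD('x) - 2) * s) / fact CARD('x)"

text \<open>The summand \<open>y = v\<close> is always \<open>A u v\<close>.  For \<open>y \<noteq> v\<close> the value \<open>h y\<close> takes every
  \<open>x \<noteq> u\<close> equally often, so the summand contributes a multiple of the column sum at \<open>y\<close>
  without its entry in row \<open>u\<close>.\<close>

lemma sum_traces:
  fixes A :: "'x::finite \<Rightarrow> 'x \<Rightarrow> real"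
  assumes row: "\<And>x. (\<Sum>y\<in>UNIV. A x y) = s"
    and col: "\<And>y. (\<Sum>x\<in>UNIV. A x y) = s"
  shows "(\<Sum>h | bij h \<and> h v = u. \<Sum>y\<in>UNIV. A (h y) y) =
    fact (CARD('x) - 1) * A u v +
    fact (CARD('x) - 2) * ((real CARD('x) - 2) * s + A u v)"
proof -
  let ?P = "{h. bij h \<and> h v = u}"
  have off: "(\<Sum>h\<in>?P. A (h y) y) = fact (CARD('x) - 2) * (s - A u y)" if "y \<noteq> v" for y
  proof -
    have "(\<Sum>h\<in>?P. A (h y) y) = (\<Sum>x\<in>- {u}. \<Sum>h | h \<in> ?P \<and> h y = x. A (h y) y)"
      using that by (intro sum.group[symmetric]) (auto dest: bij_is_inj injD)
    also have "\<dots> = (\<Sum>x\<in>- {u}. fact (CARD('x) - 2) * A x y)"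
    proof (rule sum.cong[OF refl])
      fix x assume "x \<in> - {u}"
      then have "card {h. bij h \<and> h v = u \<and> h y = x} = fact (CARD('x) - 2)"
        using that by (intro card_bij_two_values) auto
      moreover have "(\<Sum>h | h \<in> ?P \<and> h y = x. A (h y) y) = (\<Sum>h | h \<in> ?P \<and> h y = x. A x y)"
        by (rule sum.cong) auto
      ultimately show "(\<Sum>h | h \<in> ?P \<and> h y = x. A (h y) y) = fact (CARD('x) - 2) * A x y"
        by (simp add: conj_ac)
    qed
    also have "\<dots> = fact (CARD('x) - 2) * (s - A u y)"
      using col[of y] by (simp add: sum_distrib_left[symmetric] Compl_eq_Diff_UNIV sum_diff)
    finally show ?thesis .
  qed
  have diag: "(\<Sum>h\<in>?P. A (h v) v) = fact (CARD('x) - 1) * A u v"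
    using card_bij_one_value[of v u] by simp
  have "(\<Sum>h\<in>?P. \<Sum>y\<in>UNIV. A (h y) y) = (\<Sum>y\<in>UNIV. \<Sum>h\<in>?P. A (h y) y)"
    by (rule sum.swap)
  also have "\<dots> = (\<Sum>h\<in>?P. A (h v) v) + (\<Sum>y\<in>UNIV - {v}. \<Sum>h\<in>?P. A (h y) y)"
    by (rule sum.remove) auto
  also have "(\<Sum>y\<in>UNIV - {v}. \<Sum>h\<in>?P. A (h y) y)
      = (\<Sum>y\<in>UNIV - {v}. fact (CARD('x) - 2) * (s - A u y))"
    by (intro sum.cong) (auto simp: off)
  also have "\<dots> = fact (CARD('x) - 2) * ((\<Sum>y\<in>UNIV. s - A u y) - (s - A u v))"
    by (simp add: sum_distrib_left[symmetric] sum_diff)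
  also have "(\<Sum>y\<in>UNIV. s - A u y) = real CARD('x) * s - s"
    using row[of u] by (simp add: sum_subtractf)
  finally show ?thesis
    unfolding diag by (simp add: algebra_simps)
qed

lemma sum_permutation_weight:
  fixes A :: "'x::finite \<Rightarrow> 'x \<Rightarrow> real"
  assumes row: "\<And>x. (\<Sum>y\<in>UNIV. A x y) = s"
    and col: "\<And>y. (\<Sum>x\<in>UNIV. A x y) = s"
  shows "(\<Sum>h | bij h \<and> h v = u. permutation_weight A s h) = A u v"
proof -
  let ?n = "CARD('x)"
  have "(\<Sum>h | bij h \<and> h v = u. permutation_weight A s h) =
      ((real ?n - 1) * (\<Sum>h | bij h \<and> h v = u. \<Sum>y\<in>UNIV. A (h y) y)
        - real (card {h. bij h \<and> h v = u}) * ((real ?n - 2) * s)) / fact ?n"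
    by (simp add: permutation_weight_def sum_divide_distrib[symmetric] sum_subtractf
        sum_distrib_left)
  also have "\<dots> = ((real ?n - 1) * (fact (?n - 1) * A u v
        + fact (?n - 2) * ((real ?n - 2) * s + A u v))
        - fact (?n - 1) * ((real ?n - 2) * s)) / fact ?n"
    by (simp add: sum_traces[OF row col] card_bij_one_value)
  also have "\<dots> = A u v"
  proof (cases "?n = 1")
    case True
    \<comment> \<open>In size one the matrix is its only entry, and the truncated \<open>n - 2\<close> is multiplied by \<open>0\<close>.\<close>
    then have univ: "UNIV = {v}"
      by (metis UNIV_I card_1_singletonE singletonD)
    then have "s = A u v"
      using row[of u] unfolding univ by simp
    with True show ?thesis by simp
  next
    case False
    moreover have "?n \<noteq> 0" by simp
    ultimately obtain m where m: "?n = Suc (Suc m)"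
      by (metis One_nat_def not0_implies_Suc)
    have "(real ?n - 1) * (fact (?n - 1) * A u v
        + fact (?n - 2) * ((real ?n - 2) * s + A u v))
        - fact (?n - 1) * ((real ?n - 2) * s) = A u v * fact ?n"
      unfolding m by (simp add: algebra_simps)
    then show ?thesis by simp
  qed
  finally show ?thesis .
qed

section \<open>Measures on the permutations and their operators\<close>

lemma Aut_eq: "Aut = {h. bij h}"
  by (auto simp: BijGroup_def Bij_def)

lemma finite_signed_measure_sum:
  fixes m :: "'a \<Rightarrow> real"
  assumes "finite \<Omega>"
  shows "finite_signed_measure \<Omega> (Pow \<Omega>) (sum m)"
  unfolding finite_signed_measure_def
proof (intro conjI allI impI)
  show "sigma_algebra \<Omega> (Pow \<Omega>)"
    by (rule sigma_algebra_Pow)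
  show "sum m {} = 0" by simp
  fix B :: "nat \<Rightarrow> 'a set"
  assume B: "range B \<subseteq> Pow \<Omega>" "disjoint_family B"
  have point: "(\<lambda>n. if h \<in> B n then m h else 0) sums (if h \<in> (\<Union>n. B n) then m h else 0)" for h
  proof (cases "h \<in> (\<Union>n. B n)")
    case True
    then obtain i where "h \<in> B i" by blast
    then have "(h \<in> B n) = (n = i)" for n
      using B(2) by (auto simp: disjoint_family_on_def)
    with True show ?thesis
      using sums_single[of i "\<lambda>_. m h"] by simp
  qed simp
  have restrict: "sum m H = (\<Sum>h\<in>\<Omega>. if h \<in> H then m h else 0)" if "H \<subseteq> \<Omega>" for H
    using that assms by (simp add: sum.If_cases Int_absorb1)
  have "(\<lambda>n. \<Sum>h\<in>\<Omega>. if h \<in> B n then m h else 0) sums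
      (\<Sum>h\<in>\<Omega>. if h \<in> (\<Union>n. B n) then m h else 0)"
    by (rule sums_sum) (rule point)
  moreover have "B n \<subseteq> \<Omega>" for n using B(1) by auto
  then have "sum m (B n) = (\<Sum>h\<in>\<Omega>. if h \<in> B n then m h else 0)"
    "sum m (\<Union>n. B n) = (\<Sum>h\<in>\<Omega>. if h \<in> (\<Union>n. B n) then m h else 0)" for n
    by (intro restrict; blast)+
  ultimately show "(\<lambda>n. sum m (B n)) sums sum m (\<Union>n. B n)" by simp
qed

lemma bij_conjugation:
  fixes g :: "'a \<Rightarrow> 'a"
  assumes "bij g"
  shows "bij_betw (\<lambda>h. g \<circ> h \<circ> inv_into UNIV g) {h. bij h} {h. bij h}"
proof (rule bij_betw_byWitness[where f' = "\<lambda>h. inv_into UNIV g \<circ> h \<circ> g"])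
  note g = bij_is_inj[OF assms] bij_is_surj[OF assms]
  show "\<forall>h\<in>{h. bij h}. inv_into UNIV g \<circ> (g \<circ> h \<circ> inv_into UNIV g) \<circ> g = h"
    using g by (simp add: fun_eq_iff)
  show "\<forall>h\<in>{h. bij h}. g \<circ> (inv_into UNIV g \<circ> h \<circ> g) \<circ> inv_into UNIV g = h"
    using g by (simp add: fun_eq_iff surj_f_inv_f)
qed (use assms in \<open>auto intro!: bij_comp bij_imp_bij_inv\<close>)

lemma permutant_measure_sum:
  fixes G :: "('x::finite \<Rightarrow> 'x) set"
  assumes G: "\<And>g. g \<in> G \<Longrightarrow> bij g"
    and m: "\<And>g h. g \<in> G \<Longrightarrow> bij h \<Longrightarrow> m (g \<circ> h \<circ> inv_into UNIV g) = m h"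
  shows "permutant_measure G (sum m)"
  unfolding permutant_measure_def
proof (intro conjI allI impI)
  show "finite_signed_measure Aut (Pow Aut) (sum m)"
    by (rule finite_signed_measure_sum) simp
  fix H :: "('x \<Rightarrow> 'x) set" and g assume H: "H \<subseteq> Aut" and g: "g \<in> G"
  have "inj_on (\<lambda>h. g \<circ> h \<circ> inv_into UNIV g) H"
    using bij_betw_imp_inj_on[OF bij_conjugation[OF G[OF g]]] H
    unfolding Aut_eq by (rule inj_on_subset)
  then show "sum m H = sum m ((\<lambda>h. g \<circ> h \<circ> inv_into UNIV g) ` H)"
    using H m[OF g] by (auto simp: sum.reindex Aut_eq intro!: sum.cong)
qed

definition permutation_operator :: "(('x::finite \<Rightarrow> 'x) \<Rightarrow> real) \<Rightarrow> ('x \<Rightarrow> real) \<Rightarrow> 'x \<Rightarrow> real" where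
  "permutation_operator m \<phi> x = (\<Sum>h | bij h. m h * \<phi> (inv_into UNIV h x))"

lemma sum_scale_fun_eq_permutation_operator:
  fixes m :: "('x::finite \<Rightarrow> 'x) \<Rightarrow> real"
  shows "(\<Sum>h\<in>Aut. scale_fun (m h) (\<phi> \<circ> inv_into UNIV h)) = permutation_operator m \<phi>"
proof
  fix x
  have "(\<Sum>h\<in>S. f h) x = (\<Sum>h\<in>S. f h x)" if "finite S"
    for S and f :: "('x \<Rightarrow> 'x) \<Rightarrow> 'x \<Rightarrow> real"
    using that by induction auto
  then show "(\<Sum>h\<in>Aut. scale_fun (m h) (\<phi> \<circ> inv_into UNIV h)) x = permutation_operator m \<phi> x"
    by (simp add: Aut_eq permutation_operator_def scale_fun_def)
qed

lemma vector_space_scale_fun: "vector_space (scale_fun :: real \<Rightarrow> ('x \<Rightarrow> real) \<Rightarrow> 'x \<Rightarrow> real)"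
  by unfold_locales (auto simp: scale_fun_def fun_eq_iff algebra_simps)

lemma linear_permutation_operator:
  "Vector_Spaces.linear scale_fun scale_fun (permutation_operator m)"
  unfolding Vector_Spaces.linear_iff
  by (auto simp: vector_space_scale_fun fun_eq_iff permutation_operator_def scale_fun_def
      algebra_simps sum.distrib sum_distrib_left)

lemma GEO_permutation_operator:
  fixes G :: "('x::finite \<Rightarrow> 'x) set"
  assumes G: "\<And>g. g \<in> G \<Longrightarrow> bij g"
    and m: "\<And>g h. g \<in> G \<Longrightarrow> bij h \<Longrightarrow> m (g \<circ> h \<circ> inv_into UNIV g) = m h"
  shows "GEO G (permutation_operator m)"
  unfolding GEO_def
proof (intro allI ballI ext)
  fix \<phi> g x assume g: "g \<in> G"
  note bij = G[OF g]
  have "permutation_operator m \<phi> (g x) = (\<Sum>h | bij h.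
      m (g \<circ> h \<circ> inv_into UNIV g) * \<phi> (inv_into UNIV (g \<circ> h \<circ> inv_into UNIV g) (g x)))"
    unfolding permutation_operator_def
    by (rule sum.reindex_bij_betw[OF bij_conjugation[OF bij], symmetric])
  also have "\<dots> = (\<Sum>h | bij h. m h * \<phi> (g (inv_into UNIV h x)))"
    using bij m[OF g]
    by (intro sum.cong) (auto simp: o_inv_distrib bij_comp bij_imp_bij_inv inv_inv_eq bij_is_inj)
  also have "\<dots> = permutation_operator m (\<phi> \<circ> g) x"
    by (simp add: permutation_operator_def)
  finally show "permutation_operator m (\<phi> \<circ> g) x = (permutation_operator m \<phi> \<circ> g) x"
    by simp
qed

text \<open>Since \<open>h\<^sup>-\<^sup>1 u = v\<close> means \<open>h v = u\<close>, the matrix entry at \<open>(u, v)\<close> of the operator collects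
  the weights of these \<open>h\<close>.\<close>

lemma permutation_operator_matrix:
  "permutation_operator m \<phi> u = (\<Sum>v\<in>UNIV. (\<Sum>h | bij h \<and> h v = u. m h) * \<phi> v)"
proof -
  have "permutation_operator m \<phi> u =
      (\<Sum>v\<in>UNIV. \<Sum>h | h \<in> {h. bij h} \<and> inv_into UNIV h u = v. m h * \<phi> (inv_into UNIV h u))"
    unfolding permutation_operator_def by (intro sum.group[symmetric]) auto
  also have "\<dots> = (\<Sum>v\<in>UNIV. \<Sum>h | bij h \<and> h v = u. m h * \<phi> v)"
    by (intro sum.cong) (auto simp: bij_is_inj bij_is_surj surj_f_inv_f)
  finally show ?thesis
    by (simp add: sum_distrib_right)
qed

section \<open>The matrix of a linear equivariant operator\<close>

definition operator_matrix :: "(('x \<Rightarrow> real) \<Rightarrow> ('x \<Rightarrow> real)) \<Rightarrow> 'x \<Rightarrow> 'x \<Rightarrow> real" where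
  "operator_matrix F x y = F (\<lambda>z. of_bool (z = y)) x"

lemma linear_eq_operator_matrix:
  fixes F :: "('x::finite \<Rightarrow> real) \<Rightarrow> ('x \<Rightarrow> real)"
  assumes "Vector_Spaces.linear scale_fun scale_fun F"
  shows "F \<phi> x = (\<Sum>y\<in>UNIV. operator_matrix F x y * \<phi> y)"
proof -
  have add: "F (\<phi> + \<psi>) = F \<phi> + F \<psi>" and scale: "F (scale_fun c \<phi>) x = c * F \<phi> x" for \<phi> \<psi> c
    using assms by (simp_all add: Vector_Spaces.linear_iff scale_fun_def)
  have "F (\<lambda>z. if z \<in> S then \<phi> z else 0) x = (\<Sum>y\<in>S. operator_matrix F x y * \<phi> y)"
    if "finite S" for S
    using that
  proof induction
    case empty
    show ?case
      using scale[of 0] by (simp add: scale_fun_def fun_eq_iff)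
  next
    case (insert a S)
    have "(\<lambda>z. if z \<in> insert a S then \<phi> z else 0) =
        scale_fun (\<phi> a) (\<lambda>z. of_bool (z = a)) + (\<lambda>z. if z \<in> S then \<phi> z else 0)"
      using insert.hyps by (auto simp: scale_fun_def fun_eq_iff)
    then show ?case
      using insert by (simp add: add scale operator_matrix_def)
  qed
  from this[of UNIV] show ?thesis by simp
qed

lemma operator_matrix_invariant:
  assumes "GEO G F" "g \<in> G" "bij g"
  shows "operator_matrix F (g x) (g y) = operator_matrix F x y"
proof -
  have "F (\<lambda>z. of_bool (z = g y)) (g x) = F ((\<lambda>z. of_bool (z = g y)) \<circ> g) x"
    using assms by (simp add: GEO_def)
  also have "(\<lambda>z. of_bool (z = g y)) \<circ> g = (\<lambda>z. of_bool (z = y) :: real)"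
    using assms(3) by (auto simp: fun_eq_iff dest: bij_is_inj injD)
  finally show ?thesis
    by (simp add: operator_matrix_def)
qed

text \<open>An invariant function of two points has constant marginals, because a group element
  taking one point to another permutes the summands.  The common row sum and the common column
  sum agree, since either one times the number of points is the sum of all entries.\<close>

lemma transitive_invariant_constant_line_sums:
  fixes A :: "'x::finite \<Rightarrow> 'x \<Rightarrow> real"
  assumes bij: "\<And>g. g \<in> G \<Longrightarrow> bij g"
    and transitive: "\<And>x y. \<exists>g\<in>G. g x = y"
    and inv: "\<And>g x y. g \<in> G \<Longrightarrow> A (g x) (g y) = A x y"
  obtains s where "\<And>x. (\<Sum>y\<in>UNIV. A x y) = s" "\<And>y. (\<Sum>x\<in>UNIV. A x y) = s"
proof -
  have marginal: "(\<Sum>y\<in>UNIV. B x y) = (\<Sum>y\<in>UNIV. B x' y)"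
    if B: "\<And>g x y. g \<in> G \<Longrightarrow> B (g x) (g y) = B x y" for B :: "'x \<Rightarrow> 'x \<Rightarrow> real" and x x'
  proof -
    obtain g where g: "g \<in> G" "g x = x'"
      using transitive by blast
    have "(\<Sum>y\<in>UNIV. B x' y) = (\<Sum>y\<in>UNIV. B (g x) (g y))"
      using sum.reindex_bij_betw[OF bij[OF g(1)], of "B x'"] g(2) by simp
    then show ?thesis
      using B[OF g(1)] by simp
  qed
  obtain x0 :: 'x where True by simp
  define r where "r = (\<Sum>y\<in>UNIV. A x0 y)"
  define c where "c = (\<Sum>x\<in>UNIV. A x x0)"
  have row: "(\<Sum>y\<in>UNIV. A x y) = r" for x
    unfolding r_def by (rule marginal) (rule inv)
  have col: "(\<Sum>x\<in>UNIV. A x y) = c" for y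
    unfolding c_def by (rule marginal[of "\<lambda>y x. A x y"]) (rule inv)
  have "real CARD('x) * r = real CARD('x) * c"
    using sum.swap[of A UNIV UNIV] by (simp add: row col)
  then have "r = c" by simp
  with row col show ?thesis
    using that by blast
qed

text \<open>The trace defining the weight is a sum over all points, and conjugating the permutation
  merely reorders that sum.\<close>

lemma permutation_weight_conjugate:
  fixes A :: "'x::finite \<Rightarrow> 'x \<Rightarrow> real"
  assumes bij: "bij g"
    and inv: "\<And>x y. A (g x) (g y) = A x y"
  shows "permutation_weight A s (g \<circ> h \<circ> inv_into UNIV g) = permutation_weight A s h"
proof -
  have "(\<Sum>y\<in>UNIV. A ((g \<circ> h \<circ> inv_into UNIV g) y) y) =
      (\<Sum>y\<in>UNIV. A ((g \<circ> h \<circ> inv_into UNIV g) (g y)) (g y))"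
    by (rule sum.reindex_bij_betw[OF bij, symmetric])
  also have "\<dots> = (\<Sum>y\<in>UNIV. A (h y) y)"
    using bij by (simp add: bij_is_inj inv)
  finally show ?thesis
    by (simp add: permutation_weight_def)
qed

section \<open>Representation by permutant measures\<close>

theorem theorem2:
  fixes G :: "('x::finite \<Rightarrow> 'x) set"
    and F :: "('x \<Rightarrow> real) \<Rightarrow> ('x \<Rightarrow> real)"
  assumes "subgroup G Aut_group"
    and "transitive_on_points G"
  shows "linear_GEO G F \<longleftrightarrow>
    (\<exists>\<mu>. permutant_measure G \<mu> \<and>
      (\<forall>\<phi>. F \<phi> = (\<Sum>h\<in>Aut. scale_fun (\<mu> {h}) (\<phi> \<circ> inv_into UNIV h))))"
proof -
  have bij: "bij g" if "g \<in> G" for g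
    using subgroup.subset[OF assms(1)] that by (auto simp: Aut_eq)
  show ?thesis
  proof
    assume "linear_GEO G F"
    then have lin: "Vector_Spaces.linear scale_fun scale_fun F" and geo: "GEO G F"
      by (auto simp: linear_GEO_def)
    define A where "A = operator_matrix F"
    have inv: "A (g x) (g y) = A x y" if "g \<in> G" for g x y
      unfolding A_def by (rule operator_matrix_invariant[OF geo that bij[OF that]])
    have transitive: "\<exists>g\<in>G. g x = y" for x y
      using transitive_action.unique_orbit[OF assms(2)[unfolded transitive_on_points_def], of x y]
      by simp
    obtain s where s: "\<And>x. (\<Sum>y\<in>UNIV. A x y) = s" "\<And>y. (\<Sum>x\<in>UNIV. A x y) = s"
      using transitive_invariant_constant_line_sums[of G A] bij transitive inv by blast
    define m where "m = permutation_weight A s"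
    have "permutant_measure G (sum m)"
      by (rule permutant_measure_sum[OF bij])
        (simp_all add: m_def permutation_weight_conjugate bij inv)
    moreover have "F \<phi> = permutation_operator m \<phi>" for \<phi>
      by (simp add: fun_eq_iff permutation_operator_matrix m_def sum_permutation_weight[OF s]
          linear_eq_operator_matrix[OF lin] A_def[symmetric])
    ultimately show "\<exists>\<mu>. permutant_measure G \<mu> \<and>
        (\<forall>\<phi>. F \<phi> = (\<Sum>h\<in>Aut. scale_fun (\<mu> {h}) (\<phi> \<circ> inv_into UNIV h)))"
      by (intro exI[of _ "sum m"]) (simp add: sum_scale_fun_eq_permutation_operator)
  next
    assume "\<exists>\<mu>. permutant_measure G \<mu> \<and>
        (\<forall>\<phi>. F \<phi> = (\<Sum>h\<in>Aut. scale_fun (\<mu> {h}) (\<phi> \<circ> inv_into UNIV h)))"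
    then obtain \<mu> where \<mu>: "permutant_measure G \<mu>"
      and F: "F = permutation_operator (\<lambda>h. \<mu> {h})"
      by (auto simp: fun_eq_iff sum_scale_fun_eq_permutation_operator)
    have "\<mu> {g \<circ> h \<circ> inv_into UNIV g} = \<mu> {h}" if "g \<in> G" "bij h" for g h
    proof -
      have "{h} \<subseteq> Aut"
        using that(2) by (simp add: Aut_eq)
      then have "\<mu> {h} = \<mu> ((\<lambda>h. g \<circ> h \<circ> inv_into UNIV g) ` {h})"
        using \<mu> that(1) unfolding permutant_measure_def by blast
      then show ?thesis by simp
    qed
    then show "linear_GEO G F"
      unfolding F linear_GEO_def
      by (intro conjI linear_permutation_operator GEO_permutation_operator bij)
  qed
qed

end
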